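(* Let $(\Omega,m)$ be a measure space with $\sigma$-finite nonnegative measure $m$, and let $K:\Omega\times\Omega\to[0,+\infty]$ be a nonnegative measurable kernel. Let $h$ be a measurable function such that $$0<h<+\infty\quad m\text{-a.e. in }\Omega.$$ Let $V$ be a measurable function in $\Omega$ and $q\in\mathbb{R}\setminus\{0\}$. Consider the integral equation $$u(x)+\int_{\Omega}K(x,y)\,u(y)^{q}\,V(y)\,dm(y)=h(x)\quad m\text{-a.e. in }\Omega. \tag{I}$$ Then the following statements hold. (i) For $q>1$ and $V\le 0$, suppose that $$-K(h^{q}V)(x)\le\left(1-\frac{1}{q}\right)^{q}\frac{1}{q-1}\,h(x)\quad m\text{-a.e. in }\Omega.$$ Then (I) has a minimal positive solution $u$, and it satisfies $$h(x)\le u(x)\le\frac{q}{q-1}\,h(x)\quad m\text{-a.e. in }\Omega.$$ (ii) For $q<0$ and $V\ge 0$, suppose that $$K(h^{q}V)(x)\le\left(1-\frac{1}{q}\right)^{q}\frac{1}{1-q}\,h(x)\quad m\text{-a.e. in }\Omega.$$ Then (I) has a maximal positive solution $u$, and it satisfies $$\frac{1}{1-\frac{1}{q}}\,h(x)\le u(x)\le h(x)\quad m\text{-a.e. in }\Omega.$$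
   Context: For a nonnegative measurable function $F$ on $\Omega$, $KF(x)=\int_{\Omega}K(x,y)F(y)\,dm(y)$; for $F\le 0$, $KF=-K(-F)$. A positive solution of (I) is a measurable function $u$ with $0<u<\infty$ $m$-a.e. satisfying (I) $m$-a.e. A positive solution $u$ is minimal (respectively, maximal) if $u\le\tilde{u}$ (respectively, $\tilde{u}\le u$) $m$-a.e. for every positive solution $\tilde{u}$ of (I). *)

theory Defs
  imports "HOL-Analysis.Analysis"
begin

text \<open>
  The power \<open>x\<^sup>q\<close> of an extended real. It is the intended one for \<open>0 < x < \<infinity>\<close>; it is only
  applied to functions satisfying these bounds almost everywhere, and its (finite, nonnegative)
  values elsewhere play no role.
\<close>

definition epowr :: "ereal \<Rightarrow> real \<Rightarrow> ereal" where
  "epowr x q = ereal (real_of_ereal x powr q)"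

text \<open>
  The integral of \<open>K x y * F y\<close> as positive part minus negative part. For \<open>F \<ge> 0\<close> this is the
  Lebesgue integral in \<open>[0,\<infinity>]\<close>, for \<open>F \<le> 0\<close> it is \<open>- K (- F)\<close>; see the two lemmas below.
  It is only meant for functions of constant sign (almost everywhere), so that no difference
  \<open>\<infinity> - \<infinity>\<close> arises.
\<close>

definition kernel_op ::
  "'a measure \<Rightarrow> ('a \<Rightarrow> 'a \<Rightarrow> ennreal) \<Rightarrow> ('a \<Rightarrow> ereal) \<Rightarrow> 'a \<Rightarrow> ereal" where
  "kernel_op M K F x =
     enn2ereal (\<integral>\<^sup>+ y. K x y * e2ennreal (F y) \<partial>M) -
     enn2ereal (\<integral>\<^sup>+ y. K x y * e2ennreal (- F y) \<partial>M)"

lemma kernel_op_nonneg: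
  assumes "AE y in M. 0 \<le> F y"
  shows "kernel_op M K F x = enn2ereal (\<integral>\<^sup>+ y. K x y * e2ennreal (F y) \<partial>M)"
proof -
  have "AE y in M. K x y * e2ennreal (- F y) = 0"
    using assms by eventually_elim (simp add: e2ennreal_neg)
  then have "(\<integral>\<^sup>+ y. K x y * e2ennreal (- F y) \<partial>M) = (\<integral>\<^sup>+ y. 0 \<partial>M)"
    by (rule nn_integral_cong_AE)
  then show ?thesis
    by (simp add: kernel_op_def zero_ennreal.rep_eq)
qed

lemma kernel_op_nonpos:
  assumes "AE y in M. F y \<le> 0"
  shows "kernel_op M K F x = - kernel_op M K (\<lambda>y. - F y) x"
proof -
  have "AE y in M. K x y * e2ennreal (F y) = 0"
    using assms by eventually_elim (simp add: e2ennreal_neg)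
  then have "(\<integral>\<^sup>+ y. K x y * e2ennreal (F y) \<partial>M) = (\<integral>\<^sup>+ y. 0 \<partial>M)"
    by (rule nn_integral_cong_AE)
  then show ?thesis
    by (simp add: kernel_op_def zero_ennreal.rep_eq)
qed

definition positive_solution ::
  "'a measure \<Rightarrow> ('a \<Rightarrow> 'a \<Rightarrow> ennreal) \<Rightarrow> ('a \<Rightarrow> ereal) \<Rightarrow> real \<Rightarrow> ('a \<Rightarrow> ereal) \<Rightarrow>
     ('a \<Rightarrow> ereal) \<Rightarrow> bool" where
  "positive_solution M K V q h u \<longleftrightarrow>
     u \<in> borel_measurable M \<and>
     (AE x in M. 0 < u x \<and> u x < \<infinity>) \<and>
     (AE x in M. u x + kernel_op M K (\<lambda>y. epowr (u y) q * V y) x = h x)"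

definition minimal_positive_solution ::
  "'a measure \<Rightarrow> ('a \<Rightarrow> 'a \<Rightarrow> ennreal) \<Rightarrow> ('a \<Rightarrow> ereal) \<Rightarrow> real \<Rightarrow> ('a \<Rightarrow> ereal) \<Rightarrow>
     ('a \<Rightarrow> ereal) \<Rightarrow> bool" where
  "minimal_positive_solution M K V q h u \<longleftrightarrow>
     positive_solution M K V q h u \<and>
     (\<forall>v. positive_solution M K V q h v \<longrightarrow> (AE x in M. u x \<le> v x))"

definition maximal_positive_solution ::
  "'a measure \<Rightarrow> ('a \<Rightarrow> 'a \<Rightarrow> ennreal) \<Rightarrow> ('a \<Rightarrow> ereal) \<Rightarrow> real \<Rightarrow> ('a \<Rightarrow> ereal) \<Rightarrow>
     ('a \<Rightarrow> ereal) \<Rightarrow> bool" where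
  "maximal_positive_solution M K V q h u \<longleftrightarrow>
     positive_solution M K V q h u \<and>
     (\<forall>v. positive_solution M K V q h v \<longrightarrow> (AE x in M. v x \<le> u x))"

end

theory Submission
  imports Defs
begin

text \<open>
  Both parts become fixed point problems for the correction \<open>g = \<bar>u - h\<bar>\<close>. With
  \<open>W = \<bar>V\<bar>\<close>, equation (I) says that

    \<open>g x = \<integral> K x y * W y * (h y + g y)\<^sup>q dy\<close> for \<open>q > 1\<close>, \<open>V \<le> 0\<close>, where \<open>u = h + g\<close>;

    \<open>g x = \<integral> K x y * W y * (h y - g y)\<^sup>q dy\<close> for \<open>q < 0\<close>, \<open>V \<ge> 0\<close>, where \<open>u = h - g\<close>.

  In both cases the integrand is increasing in \<open>g\<close>, since for \<open>q < 0\<close> the decreasing power is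
  composed with the decreasing map \<open>g \<mapsto> h - g\<close>. Hence the least \<open>g\<close> gives the minimal solution
  in the first case and the maximal one in the second. If the power is extended to \<open>[0,\<infinity>]\<close> by
  its limits and the difference \<open>h - g\<close> is truncated at \<open>0\<close>, the
  integrand also commutes with increasing limits, so monotone convergence makes the iterates
  starting from \<open>0\<close> converge to a solution \<open>g\<close>, possibly with infinite values, that lies below every supersolution (\<open>least_integral_fixed_point\<close>).

  The smallness condition exhibits a multiple of \<open>h\<close> as a supersolution. Put
  \<open>c = 1 / (1 - 1 / q) = q / (q - 1)\<close> and \<open>D = \<bar>c - 1\<bar> = 1 / \<bar>q - 1\<bar>\<close>. For \<open>g = D * h\<close> the
  base of the power is \<open>c * h\<close> in either case, so the right-hand side is \<open>c\<^sup>q\<close> times the integral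
  with \<open>h\<^sup>q\<close>; the condition bounds that integral by \<open>c\<^sup>-\<^sup>q * D * h\<close>, and the
  powers of \<open>c\<close> cancel (\<open>integral_ennpowr_scaled_le\<close>). The bound \<open>0 \<le> g \<le> D * h\<close> is the stated
  two-sided estimate for \<open>u\<close>, and it makes \<open>u\<close> positive and finite.
\<close>

section \<open>Least fixed points of monotone integral operators\<close>

text \<open>
  Kleene iteration from \<open>0\<close>: the iterates increase, and by monotone convergence their supremum is
  a fixed point. A supersolution dominates every iterate. Values in \<open>[0,\<infinity>]\<close> make the
  supremum exist without any bound; finiteness comes later, from a concrete supersolution.
\<close>

lemma least_integral_fixed_point:
  fixes K :: "'a \<Rightarrow> 'a \<Rightarrow> ennreal" and \<Phi> :: "'a \<Rightarrow> ennreal \<Rightarrow> ennreal"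
  assumes "sigma_finite_measure M"
    and K [measurable]: "case_prod K \<in> borel_measurable (M \<Otimes>\<^sub>M M)"
    and \<Phi> [measurable]: "case_prod \<Phi> \<in> borel_measurable (M \<Otimes>\<^sub>M borel)"
    and cont: "\<And>y. sup_continuous (\<Phi> y)"
  obtains g where "g \<in> borel_measurable M"
    and "\<And>x. x \<in> space M \<Longrightarrow> g x = (\<integral>\<^sup>+ y. K x y * \<Phi> y (g y) \<partial>M)"
    and "\<And>b. AE x in M. (\<integral>\<^sup>+ y. K x y * \<Phi> y (b y) \<partial>M) \<le> b x \<Longrightarrow> AE x in M. g x \<le> b x"
proof -
  interpret sigma_finite_measure M by fact
  define S where "S f = (\<lambda>x. \<integral>\<^sup>+ y. K x y * \<Phi> y (f y) \<partial>M)" for f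
  define g where "g n = (S ^^ n) (\<lambda>_. 0)" for n
  have g_Suc: "g (Suc n) = S (g n)" for n
    by (simp add: g_def)
  have \<Phi>_mono: "\<Phi> y s \<le> \<Phi> y t" if "s \<le> t" for y s t
    using sup_continuous_mono[OF cont] that by (rule monoD)
  have S_mono: "S f1 \<le> S f2" if "f1 \<le> f2" for f1 f2
    unfolding S_def le_fun_def using that
    by (auto intro!: nn_integral_mono mult_left_mono \<Phi>_mono simp: le_fun_def)
  have g_meas [measurable]: "g n \<in> borel_measurable M" for n
  proof (induction n)
    case (Suc n)
    note [measurable] = Suc
    show ?case unfolding g_Suc S_def by measurable
  qed (simp add: g_def)
  have "g n \<le> g (Suc n)" for n
  proof (induction n)
    case (Suc n)
    then show ?case unfolding g_Suc[of n] g_Suc[of "Suc n"] by (rule S_mono)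
  qed (simp add: g_def le_fun_def)
  then have inc: "incseq g"
    by (rule incseq_SucI)
  have inc_x: "incseq (\<lambda>n. g n y)" for y
    using inc by (auto simp: incseq_def le_fun_def)
  define G where "G x = (SUP n. g n x)" for x
  have G_meas: "G \<in> borel_measurable M"
    unfolding G_def by measurable
  have "G x = (\<integral>\<^sup>+ y. K x y * \<Phi> y (G y) \<partial>M)" if x: "x \<in> space M" for x
  proof -
    note [measurable] = measurable_compose[OF measurable_Pair1'[OF x] K, simplified]
    have "(\<integral>\<^sup>+ y. K x y * \<Phi> y (G y) \<partial>M) = (\<integral>\<^sup>+ y. (SUP n. K x y * \<Phi> y (g n y)) \<partial>M)"
      unfolding G_def using inc_x
      by (simp add: sup_continuousD[OF cont] SUP_mult_left_ennreal image_comp)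
    also have "\<dots> = (SUP n. S (g n) x)"
      unfolding S_def
    proof (rule nn_integral_monotone_convergence_SUP)
      show "incseq (\<lambda>n y. K x y * \<Phi> y (g n y))"
        using inc by (auto simp: incseq_def le_fun_def intro!: mult_left_mono \<Phi>_mono)
    qed measurable
    also have "\<dots> = (SUP n. g (Suc n) x)"
      by (simp add: g_Suc)
    also have "\<dots> = G x"
      unfolding G_def using inc_x[of x] by (intro antisym SUP_least SUP_upper2[OF UNIV_I])
        (auto intro: SUP_upper incseq_SucD)
    finally show ?thesis ..
  qed
  moreover have "AE x in M. G x \<le> b x" if b: "AE x in M. S b x \<le> b x" for b
  proof -
    have "AE x in M. g n x \<le> b x" for n
    proof (induction n)
      case (Suc n)
      have S_le: "S (g n) x \<le> S b x" for x
        unfolding S_def using Suc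
        by (intro nn_integral_mono_AE) (auto elim!: eventually_mono intro!: mult_left_mono \<Phi>_mono)
      show ?case
        using b unfolding g_Suc by eventually_elim (rule order_trans[OF S_le])
    qed (simp add: g_def)
    then have "AE x in M. \<forall>n. g n x \<le> b x"
      by (simp add: AE_all_countable)
    then show ?thesis
      unfolding G_def by eventually_elim (auto intro: SUP_least)
  qed
  ultimately show thesis
    using that G_meas unfolding S_def by blast
qed

section \<open>Powers on the extended half-line\<close>

text \<open>
  For \<open>r \<noteq> 0\<close> this is the continuous extension of \<open>s\<^sup>r\<close> from \<open>(0,\<infinity>)\<close> to
  \<open>[0,\<infinity>]\<close>. The limits at both ends make \<open>s \<mapsto> s\<^sup>r\<close> a monotone or antitone bijection of the
  complete lattice \<open>[0,\<infinity>]\<close>, with inverse \<open>s \<mapsto> s\<^sup>1\<^sup>/\<^sup>r\<close>.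
\<close>

definition ennpowr :: "ennreal \<Rightarrow> real \<Rightarrow> ennreal" where
  "ennpowr s r =
     (if s = top then if 0 < r then top else 0
      else if s = 0 \<and> r < 0 then top
      else ennreal (enn2real s powr r))"

lemma measurable_ennpowr [measurable]: "(\<lambda>s. ennpowr s r) \<in> borel_measurable borel"
  unfolding ennpowr_def by measurable

lemma ennpowr_ennreal: "0 < a \<Longrightarrow> ennpowr (ennreal a) r = ennreal (a powr r)"
  by (simp add: ennpowr_def)

lemma ennpowr_mono: "0 < r \<Longrightarrow> s \<le> t \<Longrightarrow> ennpowr s r \<le> ennpowr t r"
  by (cases s; cases t) (auto simp: ennpowr_def top_unique intro!: ennreal_leI powr_mono2)

lemma ennpowr_antimono: "r < 0 \<Longrightarrow> s \<le> t \<Longrightarrow> ennpowr t r \<le> ennpowr s r"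
  by (cases s; cases t) (auto simp: ennpowr_def top_unique intro!: ennreal_leI powr_mono2')

lemma ennpowr_ennpowr_inverse: "r \<noteq> 0 \<Longrightarrow> ennpowr (ennpowr s r) (1 / r) = s"
  by (cases s) (auto simp: ennpowr_def powr_powr divide_less_0_iff)

text \<open>
  The next two equivalences say that the powers \<open>r\<close> and \<open>1 / r\<close> form a Galois connection,
  an antitone one for \<open>r < 0\<close>; this is how suprema are carried through the power below.
\<close>

lemma ennpowr_le_iff_pos: "0 < r \<Longrightarrow> ennpowr s r \<le> c \<longleftrightarrow> s \<le> ennpowr c (1 / r)"
  using ennpowr_mono[of r s "ennpowr c (1/r)"] ennpowr_mono[of "1/r" "ennpowr s r" c]
    ennpowr_ennpowr_inverse[of r s] ennpowr_ennpowr_inverse[of "1/r" c]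
  by auto

lemma ennpowr_le_iff_neg: "r < 0 \<Longrightarrow> ennpowr s r \<le> c \<longleftrightarrow> ennpowr c (1 / r) \<le> s"
  using ennpowr_antimono[of r "ennpowr c (1/r)" s] ennpowr_antimono[of "1/r" "ennpowr s r" c]
    ennpowr_ennpowr_inverse[of r s] ennpowr_ennpowr_inverse[of "1/r" c]
  by auto

lemma ennpowr_cmult:
  "0 < c \<Longrightarrow> ennpowr (ennreal c * s) r = ennreal (c powr r) * ennpowr s r"
  by (cases s) (auto simp: ennpowr_def powr_mult ennreal_mult_top enn2real_mult ennreal_zero_less_mult_iff
     simp flip: ennreal_mult)

lemma e2ennreal_epowr:
  assumes "0 < x" "x < \<infinity>"
  shows "e2ennreal (epowr x q) = ennpowr (e2ennreal x) q"
  using assms by (cases x) (auto simp: epowr_def ennpowr_ennreal)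

lemma sup_continuous_ennpowr_add:
  assumes "0 < r"
  shows "sup_continuous (\<lambda>t. w * ennpowr (a + t) r)"
unfolding sup_continuous_def
proof (intro allI impI)
  fix t :: "nat \<Rightarrow> ennreal"
  have "ennpowr (a + (SUP n. t n)) r \<le> c \<longleftrightarrow> (SUP n. ennpowr (a + t n) r) \<le> c" for c
    by (simp add: ennpowr_le_iff_pos[OF assms] SUP_le_iff ennreal_SUP_add_right)
  then have "ennpowr (a + (SUP n. t n)) r = (SUP n. ennpowr (a + t n) r)"
    by (intro antisym) auto
  then show "w * ennpowr (a + (SUP n. t n)) r = (SUP n. w * ennpowr (a + t n) r)"
    by (simp add: SUP_mult_left_ennreal)
qed 

text \<open>
  Two order reversals cancel here: \<open>a - t\<close> turns the supremum into an infimum, and the negative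
  power turns it back. For \<open>a = \<infinity>\<close> the function is constant, because \<open>\<infinity> - t = \<infinity>\<close> even at
  \<open>t = \<infinity>\<close>.
\<close>

lemma sup_continuous_ennpowr_diff:
  assumes "r < 0"
  shows "sup_continuous (\<lambda>t. w * ennpowr (a - t) r)"
proof (cases "a = top")
  case False
  show ?thesis
  unfolding sup_continuous_def
proof (intro allI impI)
    fix t :: "nat \<Rightarrow> ennreal"
    have "ennpowr (a - (SUP n. t n)) r \<le> c \<longleftrightarrow> (SUP n. ennpowr (a - t n) r) \<le> c" for c
      using False
      by (simp add: ennpowr_le_iff_neg[OF assms] SUP_le_iff le_INF_iff
         less_top flip: ennreal_SUP_const_minus)
    then have "ennpowr (a - (SUP n. t n)) r = (SUP n. ennpowr (a - t n) r)"
      by (intro antisym) auto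
    then show "w * ennpowr (a - (SUP n. t n)) r = (SUP n. w * ennpowr (a - t n) r)"
      by (simp add: SUP_mult_left_ennreal)
  qed
qed (simp add: sup_continuous_const)

section \<open>The kernel operator on powers\<close>

lemma epowr_nonneg: "0 \<le> epowr x q"
  by (simp add: epowr_def)

lemma e2ennreal_epowr_mult:
  assumes "0 \<le> v"
  shows "e2ennreal (epowr x q * v) = e2ennreal v * e2ennreal (epowr x q)"
  using assms epowr_nonneg[of x q]
  by (metis (no_types, lifting) e2ennreal_enn2ereal enn2ereal_e2ennreal times_ennreal.rep_eq mult.commute)

lemma kernel_op_epowr_nonneg:
  assumes "AE y in M. 0 \<le> V y" and "AE y in M. 0 < u y \<and> u y < \<infinity>"
  shows "kernel_op M K (\<lambda>y. epowr (u y) q * V y) x =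
    enn2ereal (\<integral>\<^sup>+ y. K x y * (e2ennreal (V y) * ennpowr (e2ennreal (u y)) q) \<partial>M)"
proof -
  have "AE y in M. 0 \<le> epowr (u y) q * V y"
    using assms(1) by eventually_elim (simp add: epowr_nonneg)
  then have "kernel_op M K (\<lambda>y. epowr (u y) q * V y) x =
      enn2ereal (\<integral>\<^sup>+ y. K x y * e2ennreal (epowr (u y) q * V y) \<partial>M)"
    by (rule kernel_op_nonneg)
  also have "(\<integral>\<^sup>+ y. K x y * e2ennreal (epowr (u y) q * V y) \<partial>M) =
      (\<integral>\<^sup>+ y. K x y * (e2ennreal (V y) * ennpowr (e2ennreal (u y)) q) \<partial>M)"
    proof (rule nn_integral_cong_AE)
    show "AE y in M. K x y * e2ennreal (epowr (u y) q * V y) =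
        K x y * (e2ennreal (V y) * ennpowr (e2ennreal (u y)) q)"
      using assms by eventually_elim (simp add: e2ennreal_epowr_mult e2ennreal_epowr)
  qed
  finally show ?thesis .
qed

lemma kernel_op_epowr_nonpos:
  assumes "AE y in M. V y \<le> 0" and "AE y in M. 0 < u y \<and> u y < \<infinity>"
  shows "kernel_op M K (\<lambda>y. epowr (u y) q * V y) x =
    - enn2ereal (\<integral>\<^sup>+ y. K x y * (e2ennreal (- V y) * ennpowr (e2ennreal (u y)) q) \<partial>M)"
proof -
  have "AE y in M. epowr (u y) q * V y \<le> 0"
    using assms(1) by eventually_elim (simp add: epowr_nonneg ereal_mult_le_0_iff)
  then have "kernel_op M K (\<lambda>y. epowr (u y) q * V y) x =
      - kernel_op M K (\<lambda>y. epowr (u y) q * - V y) x"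
    by (simp add: kernel_op_nonpos)
  also have "\<dots> = - enn2ereal (\<integral>\<^sup>+ y. K x y * (e2ennreal (- V y) * ennpowr (e2ennreal (u y)) q) \<partial>M)"
    using assms by (subst kernel_op_epowr_nonneg) auto
  finally show ?thesis .
qed

text \<open>
  Homogeneity of the power takes the factor \<open>(1 / (1 - 1 / q))\<^sup>q\<close> out of the integral, and this
  factor is the reciprocal of the one in the hypothesis.
\<close>

lemma integral_ennpowr_scaled_le:
  fixes q D :: real
  assumes K [measurable]: "case_prod K \<in> borel_measurable (M \<Otimes>\<^sub>M M)"
    and [measurable]: "W \<in> borel_measurable M" "H \<in> borel_measurable M"
    and q: "0 < 1 - 1 / q" 
    and le: "AE x in M. (\<integral>\<^sup>+ y. K x y * (W y * ennpowr (H y) q) \<partial>M)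
      \<le> ennreal ((1 - 1 / q) powr q * D) * H x"
  shows "AE x in M. (\<integral>\<^sup>+ y. K x y * (W y * ennpowr (ennreal (1 / (1 - 1 / q)) * H y) q) \<partial>M)
      \<le> ennreal D * H x"
  using le AE_space
proof eventually_elim
  case (elim x)
  define c where "c = 1 / (1 - 1 / q)"
  have c: "0 < c" "c powr q * ((1 - 1 / q) powr q * D) = D"
    using q by (auto simp: c_def powr_divide)
  note [measurable] = measurable_compose[OF measurable_Pair1'[OF elim(2)] K, simplified]
  have "(\<integral>\<^sup>+ y. K x y * (W y * ennpowr (ennreal c * H y) q) \<partial>M) =
      (\<integral>\<^sup>+ y. ennreal (c powr q) * (K x y * (W y * ennpowr (H y) q)) \<partial>M)"
    using c by (simp add: ennpowr_cmult mult_ac)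
  also have "\<dots> = ennreal (c powr q) * (\<integral>\<^sup>+ y. K x y * (W y * ennpowr (H y) q) \<partial>M)"
    by (rule nn_integral_cmult) measurable
  also have "\<dots> \<le> ennreal (c powr q) * (ennreal ((1 - 1 / q) powr q * D) * H x)"
    using elim(1) by (rule mult_left_mono) simp
  also have "\<dots> = ennreal D * H x"
    using c(2) by (simp only: mult.assoc[symmetric] ennreal_mult'[symmetric] powr_ge_zero)
  finally show ?case
    unfolding c_def .
qed

lemma e2ennreal_add_enn2ereal: "0 \<le> x \<Longrightarrow> e2ennreal (x + enn2ereal t) = e2ennreal x + t"
  by (metis e2ennreal_enn2ereal enn2ereal_e2ennreal plus_ennreal.rep_eq)

lemma e2ennreal_diff_enn2ereal: "0 \<le> x \<Longrightarrow> e2ennreal (x - enn2ereal t) = e2ennreal x - t"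
  by (metis e2eenreal_enn2ereal_diff enn2ereal_e2ennreal)

lemma le_ennreal_mult_e2ennreal:
  assumes "enn2ereal a \<le> ereal C * x" "0 \<le> C" "0 \<le> x"
  shows "a \<le> ennreal C * e2ennreal x"
  using assms by (simp add: less_eq_ennreal.rep_eq times_ennreal.rep_eq enn2ereal_e2ennreal)

section \<open>Extremal positive solutions\<close>

text \<open>
  Every positive solution \<open>v\<close> has the form \<open>h + b\<close> with \<open>b\<close> a fixed point of the operator of which
  \<open>g\<close> is the least one, so minimality of \<open>h + g\<close> is leastness of \<open>g\<close>.
\<close>

lemma minimal_solution_superlinear:
  fixes M :: "'a measure" and h V :: "'a \<Rightarrow> ereal" and q :: real
  assumes sf: "sigma_finite_measure M"
    and K: "case_prod K \<in> borel_measurable (M \<Otimes>\<^sub>M M)"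
    and h [measurable]: "h \<in> borel_measurable M"
    and h_pos: "AE x in M. 0 < h x \<and> h x < \<infinity>"
    and V [measurable]: "V \<in> borel_measurable M"
    and q: "1 < q"
    and V_neg: "AE x in M. V x \<le> 0"
    and le: "AE x in M. - kernel_op M K (\<lambda>y. epowr (h y) q * V y) x
      \<le> ereal ((1 - 1 / q) powr q * (1 / (q - 1))) * h x"
  shows "\<exists>u. minimal_positive_solution M K V q h u \<and>
    (AE x in M. h x \<le> u x \<and> u x \<le> ereal (q / (q - 1)) * h x)"
proof -
  define H where "H x = e2ennreal (h x)" for x
  define W where "W x = e2ennreal (- V x)" for x
  have [measurable]: "H \<in> borel_measurable M" "W \<in> borel_measurable M"
    unfolding H_def W_def by measurable
  have meas: "case_prod (\<lambda>y t. W y * ennpowr (H y + t) q) \<in> borel_measurable (M \<Otimes>\<^sub>M borel)"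
    by measurable
  have cont: "sup_continuous (\<lambda>t. W y * ennpowr (H y + t) q)" for y
    using q by (intro sup_continuous_ennpowr_add) simp
  obtain g where [measurable]: "g \<in> borel_measurable M"
    and g: "\<And>x. x \<in> space M \<Longrightarrow> g x = (\<integral>\<^sup>+ y. K x y * (W y * ennpowr (H y + g y) q) \<partial>M)"
    and g_least: "\<And>b. AE x in M. (\<integral>\<^sup>+ y. K x y * (W y * ennpowr (H y + b y) q) \<partial>M) \<le> b x \<Longrightarrow>
      AE x in M. g x \<le> b x"
    by (rule least_integral_fixed_point[OF sf K meas cont]) blast

  have g_le: "AE x in M. g x \<le> ennreal (1 / (q - 1)) * H x"
  proof (rule g_least)
    have "H y + ennreal (1 / (q - 1)) * H y = ennreal (1 / (1 - 1 / q)) * H y" for y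
    proof -
      have "1 / (1 - 1 / q) = 1 + 1 / (q - 1)"
        using q by (simp add: divide_simps)
      then show ?thesis
        using q by (simp add: ennreal_plus distrib_right)
    qed
    moreover have "AE x in M. (\<integral>\<^sup>+ y. K x y * (W y * ennpowr (H y) q) \<partial>M)
        \<le> ennreal ((1 - 1 / q) powr q * (1 / (q - 1))) * H x"
      using le h_pos
    proof eventually_elim
      case (elim x)
      then show ?case
        using q unfolding H_def W_def
        by (intro le_ennreal_mult_e2ennreal)
          (simp_all add: kernel_op_epowr_nonpos[OF V_neg h_pos] order.strict_implies_order)
    qed
    ultimately show "AE x in M. (\<integral>\<^sup>+ y. K x y * (W y *
        ennpowr (H y + ennreal (1 / (q - 1)) * H y) q) \<partial>M) \<le> ennreal (1 / (q - 1)) * H x"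
      using q by (simp add: integral_ennpowr_scaled_le[OF K])
  qed

  define u where "u x = h x + enn2ereal (g x)" for x
  have u_bounds: "AE x in M. h x \<le> u x \<and> u x \<le> ereal (q / (q - 1)) * h x"
    using g_le h_pos
  proof eventually_elim
    case (elim x)
    then obtain a where a: "h x = ereal a" "0 < a"
      by (cases "h x") auto
    with elim have "g x \<le> ennreal (1 / (q - 1) * a)"
      using q by (simp add: H_def flip: ennreal_mult)
    then obtain b where b: "g x = ennreal b" "0 \<le> b" "b \<le> 1 / (q - 1) * a"
      using q a by (cases "g x") (auto simp: top_unique)
    have "a + 1 / (q - 1) * a = q / (q - 1) * a"
      using q by (simp add: field_simps)
    with a b show ?case
      by (simp add: u_def)
  qed
  have u_pos: "AE x in M. 0 < u x \<and> u x < \<infinity>"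
    using u_bounds h_pos
  proof eventually_elim
    case (elim x)
    then show ?case
      by (cases "h x"; cases "u x") auto
  qed
  have "positive_solution M K V q h u"
    unfolding positive_solution_def
  proof (intro conjI)
    show "u \<in> borel_measurable M"
      unfolding u_def by measurable
    have "AE y in M. e2ennreal (u y) = H y + g y"
      using h_pos by eventually_elim
        (simp add: u_def H_def e2ennreal_add_enn2ereal order.strict_implies_order)
    then have eq: "(\<integral>\<^sup>+ y. K x y * (W y * ennpowr (e2ennreal (u y)) q) \<partial>M) =
        (\<integral>\<^sup>+ y. K x y * (W y * ennpowr (H y + g y) q) \<partial>M)" for x
      by (intro nn_integral_cong_AE) (auto elim!: eventually_mono)
    show "AE x in M. u x + kernel_op M K (\<lambda>y. epowr (u y) q * V y) x = h x"
      using h_pos u_pos AE_space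
    proof eventually_elim
      case (elim x)
      then have "kernel_op M K (\<lambda>y. epowr (u y) q * V y) x = - enn2ereal (g x)"
        by (simp add: kernel_op_epowr_nonpos[OF V_neg u_pos] eq g flip: W_def)
      with elim show ?case
        by (cases "h x"; cases "g x") (auto simp: u_def)
    qed
  qed (rule u_pos)
  moreover have "AE x in M. u x \<le> v x" if v: "positive_solution M K V q h v" for v
  proof -
    define b where "b x = (\<integral>\<^sup>+ y. K x y * (W y * ennpowr (e2ennreal (v y)) q) \<partial>M)" for x
    have v_pos: "AE x in M. 0 < v x \<and> v x < \<infinity>"
      and "AE x in M. v x + kernel_op M K (\<lambda>y. epowr (v y) q * V y) x = h x"
      using v by (auto simp: positive_solution_def)
    \<comment> \<open>Since \<open>v\<close> and \<open>h\<close> are finite, the equation forces \<open>b\<close> to be finite and can be rearranged.\<close>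
    from this(2) v_pos h_pos have v_eq: "AE x in M. v x = h x + enn2ereal (b x)"
      unfolding kernel_op_epowr_nonpos[OF V_neg v_pos] W_def[symmetric] b_def[symmetric]
    proof eventually_elim
      case (elim x)
      then show ?case
        by (cases "h x"; cases "v x"; cases "b x") auto
    qed
    have "AE y in M. e2ennreal (v y) = H y + b y"
      using h_pos v_eq by eventually_elim
        (simp add: H_def e2ennreal_add_enn2ereal order.strict_implies_order)
    then have "(\<integral>\<^sup>+ y. K x y * (W y * ennpowr (H y + b y) q) \<partial>M) = b x" for x
      unfolding b_def by (intro nn_integral_cong_AE) (auto elim!: eventually_mono)
    then have "AE x in M. g x \<le> b x"
      by (intro g_least) simp
    with v_eq show ?thesis
      by eventually_elim (simp add: u_def add_left_mono flip: less_eq_ennreal.rep_eq)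
  qed
  ultimately show ?thesis
    using u_bounds unfolding minimal_positive_solution_def by blast
qed

text \<open>
  The correction is subtracted here, so the least \<open>g\<close> yields the largest \<open>h - g\<close>. The bound on
  \<open>g\<close> now also has to keep \<open>h - g\<close> away from \<open>0\<close>; it does, because \<open>1 / (1 - q) < 1\<close>.
\<close>

lemma maximal_solution_negative_power:
  fixes M :: "'a measure" and h V :: "'a \<Rightarrow> ereal" and q :: real
  assumes sf: "sigma_finite_measure M"
    and K: "case_prod K \<in> borel_measurable (M \<Otimes>\<^sub>M M)"
    and h [measurable]: "h \<in> borel_measurable M"
    and h_pos: "AE x in M. 0 < h x \<and> h x < \<infinity>"
    and V [measurable]: "V \<in> borel_measurable M"
    and q: "q < 0"
    and V_pos: "AE x in M. 0 \<le> V x"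
    and le: "AE x in M. kernel_op M K (\<lambda>y. epowr (h y) q * V y) x
      \<le> ereal ((1 - 1 / q) powr q * (1 / (1 - q))) * h x"
  shows "\<exists>u. maximal_positive_solution M K V q h u \<and>
    (AE x in M. ereal (1 / (1 - 1 / q)) * h x \<le> u x \<and> u x \<le> h x)"
proof -
  define H where "H x = e2ennreal (h x)" for x
  define W where "W x = e2ennreal (V x)" for x
  have [measurable]: "H \<in> borel_measurable M" "W \<in> borel_measurable M"
    unfolding H_def W_def by measurable
  have meas: "case_prod (\<lambda>y t. W y * ennpowr (H y - t) q) \<in> borel_measurable (M \<Otimes>\<^sub>M borel)"
    by measurable
  have cont: "sup_continuous (\<lambda>t. W y * ennpowr (H y - t) q)" for y
    using q by (intro sup_continuous_ennpowr_diff) simp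
  obtain g where [measurable]: "g \<in> borel_measurable M"
    and g: "\<And>x. x \<in> space M \<Longrightarrow> g x = (\<integral>\<^sup>+ y. K x y * (W y * ennpowr (H y - g y) q) \<partial>M)"
    and g_least: "\<And>b. AE x in M. (\<integral>\<^sup>+ y. K x y * (W y * ennpowr (H y - b y) q) \<partial>M) \<le> b x \<Longrightarrow>
      AE x in M. g x \<le> b x"
    by (rule least_integral_fixed_point[OF sf K meas cont]) blast

  have q': "0 < 1 - 1 / q" "0 < 1 / (1 - 1 / q)"
    using q by (auto simp: field_simps)
  have scale: "1 - 1 / (1 - q) = 1 / (1 - 1 / q)"
    using q by (simp add: divide_simps) (simp add: algebra_simps)
  have g_le: "AE x in M. g x \<le> ennreal (1 / (1 - q)) * H x"
  proof (rule g_least)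
    have diff: "AE y in M. H y - ennreal (1 / (1 - q)) * H y = ennreal (1 / (1 - 1 / q)) * H y"
      using h_pos
    proof eventually_elim
      case (elim y)
      then obtain a where a: "h y = ereal a" "0 < a"
        by (cases "h y") auto
      have "a - 1 / (1 - q) * a = 1 / (1 - 1 / q) * a"
        unfolding scale[symmetric] by (simp add: left_diff_distrib)
      with a q show ?case
        by (simp add: H_def ennreal_minus flip: ennreal_mult')
    qed
    have "(\<integral>\<^sup>+ y. K x y * (W y * ennpowr (H y - ennreal (1 / (1 - q)) * H y) q) \<partial>M) =
        (\<integral>\<^sup>+ y. K x y * (W y * ennpowr (ennreal (1 / (1 - 1 / q)) * H y) q) \<partial>M)" for x
      using diff by (intro nn_integral_cong_AE) (auto elim!: eventually_mono)
    moreover have "AE x in M. (\<integral>\<^sup>+ y. K x y * (W y * ennpowr (H y) q) \<partial>M)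
        \<le> ennreal ((1 - 1 / q) powr q * (1 / (1 - q))) * H x"
      using le h_pos
    proof eventually_elim
      case (elim x)
      then show ?case
        using q unfolding H_def W_def
        by (intro le_ennreal_mult_e2ennreal)
          (simp_all add: kernel_op_epowr_nonneg[OF V_pos h_pos] order.strict_implies_order)
    qed
    ultimately show "AE x in M. (\<integral>\<^sup>+ y. K x y * (W y *
        ennpowr (H y - ennreal (1 / (1 - q)) * H y) q) \<partial>M) \<le> ennreal (1 / (1 - q)) * H x"
      using q' by (simp add: integral_ennpowr_scaled_le[OF K])
  qed

  define u where "u x = h x - enn2ereal (g x)" for x
  have u_bounds: "AE x in M. ereal (1 / (1 - 1 / q)) * h x \<le> u x \<and> u x \<le> h x"
    using g_le h_pos
  proof eventually_elim
    case (elim x)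
    then obtain a where a: "h x = ereal a" "0 < a"
      by (cases "h x") auto
    with elim have "g x \<le> ennreal (1 / (1 - q) * a)"
      using q by (simp add: H_def flip: ennreal_mult)
    then obtain b where b: "g x = ennreal b" "0 \<le> b" "b \<le> 1 / (1 - q) * a"
      using q a by (cases "g x") (auto simp: top_unique)
    have "1 / (1 - 1 / q) * a = a - 1 / (1 - q) * a"
      unfolding scale[symmetric] by (simp add: left_diff_distrib)
    with a b show ?case
      by (simp add: u_def)
  qed
  have u_pos: "AE x in M. 0 < u x \<and> u x < \<infinity>"
    using u_bounds h_pos
  proof eventually_elim
    case (elim x)
    then have "0 < ereal (1 / (1 - 1 / q)) * h x"
      using q' by (simp only: ereal_zero_less_0_iff) simp
    with elim show ?case
      by auto
  qed
  have "positive_solution M K V q h u"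
    unfolding positive_solution_def
  proof (intro conjI)
    show "u \<in> borel_measurable M"
      unfolding u_def by measurable
    have "AE y in M. e2ennreal (u y) = H y - g y"
      using h_pos by eventually_elim
        (simp add: u_def H_def e2ennreal_diff_enn2ereal order.strict_implies_order)
    then have eq: "(\<integral>\<^sup>+ y. K x y * (W y * ennpowr (e2ennreal (u y)) q) \<partial>M) =
        (\<integral>\<^sup>+ y. K x y * (W y * ennpowr (H y - g y) q) \<partial>M)" for x
      by (intro nn_integral_cong_AE) (auto elim!: eventually_mono)
    show "AE x in M. u x + kernel_op M K (\<lambda>y. epowr (u y) q * V y) x = h x"
      using h_pos u_pos AE_space
    proof eventually_elim
      case (elim x)
      then have "kernel_op M K (\<lambda>y. epowr (u y) q * V y) x = enn2ereal (g x)"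
        by (simp add: kernel_op_epowr_nonneg[OF V_pos u_pos] eq g flip: W_def)
      with elim show ?case
        by (cases "h x"; cases "g x") (auto simp: u_def)
    qed
  qed (rule u_pos)
  moreover have "AE x in M. v x \<le> u x" if v: "positive_solution M K V q h v" for v
  proof -
    define b where "b x = (\<integral>\<^sup>+ y. K x y * (W y * ennpowr (e2ennreal (v y)) q) \<partial>M)" for x
    have v_pos: "AE x in M. 0 < v x \<and> v x < \<infinity>"
      and "AE x in M. v x + kernel_op M K (\<lambda>y. epowr (v y) q * V y) x = h x"
      using v by (auto simp: positive_solution_def)
    \<comment> \<open>Since \<open>v\<close> and \<open>h\<close> are finite, the equation forces \<open>b\<close> to be finite and can be rearranged.\<close>
    from this(2) v_pos h_pos have v_eq: "AE x in M. v x = h x - enn2ereal (b x)"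
      unfolding kernel_op_epowr_nonneg[OF V_pos v_pos] W_def[symmetric] b_def[symmetric]
    proof eventually_elim
      case (elim x)
      then show ?case
        by (cases "h x"; cases "v x"; cases "b x") auto
    qed
    have "AE y in M. e2ennreal (v y) = H y - b y"
      using h_pos v_eq by eventually_elim
        (simp add: H_def e2ennreal_diff_enn2ereal order.strict_implies_order)
    then have "(\<integral>\<^sup>+ y. K x y * (W y * ennpowr (H y - b y) q) \<partial>M) = b x" for x
      unfolding b_def by (intro nn_integral_cong_AE) (auto elim!: eventually_mono)
    then have "AE x in M. g x \<le> b x"
      by (intro g_least) simp
    with v_eq show ?thesis
      by eventually_elim (simp add: u_def ereal_minus_mono flip: less_eq_ennreal.rep_eq)
  qed
  ultimately show ?thesis
    using u_bounds unfolding maximal_positive_solution_def by blast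
qed

theorem theorem3p5:
  fixes M :: "'a measure"
    and K :: "'a \<Rightarrow> 'a \<Rightarrow> ennreal"
    and h V :: "'a \<Rightarrow> ereal"
    and q :: real
  assumes "sigma_finite_measure M"
    and "case_prod K \<in> borel_measurable (M \<Otimes>\<^sub>M M)"
    and "h \<in> borel_measurable M"
    and "AE x in M. 0 < h x \<and> h x < \<infinity>"
    and "V \<in> borel_measurable M"
    and "q \<noteq> 0"
  shows
    "(1 < q \<longrightarrow> (AE x in M. V x \<le> 0) \<longrightarrow>
       (AE x in M. - kernel_op M K (\<lambda>y. epowr (h y) q * V y) x
          \<le> ereal ((1 - 1 / q) powr q * (1 / (q - 1))) * h x) \<longrightarrow>
       (\<exists>u. minimal_positive_solution M K V q h u \<and>
          (AE x in M. h x \<le> u x \<and> u x \<le> ereal (q / (q - 1)) * h x))) \<and>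
     (q < 0 \<longrightarrow> (AE x in M. 0 \<le> V x) \<longrightarrow>
       (AE x in M. kernel_op M K (\<lambda>y. epowr (h y) q * V y) x
          \<le> ereal ((1 - 1 / q) powr q * (1 / (1 - q))) * h x) \<longrightarrow>
       (\<exists>u. maximal_positive_solution M K V q h u \<and>
          (AE x in M. ereal (1 / (1 - 1 / q)) * h x \<le> u x \<and> u x \<le> h x)))"
  using minimal_solution_superlinear[OF assms(1-5)] maximal_solution_negative_power[OF assms(1-5)]
  by blast

end
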